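(* Let $\mathcal{C}_0$ be a self-orthogonal code over $I_5$ of length $n$ with generator matrix $G_0=(\mathbf{r}_i)$, where $\mathbf{r}_i$ is the $i$th row of $G_0$ for $i=1,2,\dots,m$. Let $\mathbf{x}\in\mathbb{F}_5^n$ and $\alpha,\beta,\gamma,\delta\in I_5$, not all zero, such that $\alpha+\beta+2\gamma+\delta=0$. Then the code $\mathcal{C}$ over $I_5$ with generator matrix $$G=\left(\begin{array}{cccc|c} \alpha&\beta&\gamma&0&\delta\mathbf{x}\\ \hline (\mathbf{x},\mathbf{r}_1)&(\mathbf{x},\mathbf{r}_1)&2(\mathbf{x},\mathbf{r}_1)&2(\mathbf{x},\mathbf{r}_1)&\mathbf{r}_1\\ \vdots&\vdots&\vdots&\vdots&\vdots\\ (\mathbf{x},\mathbf{r}_m)&(\mathbf{x},\mathbf{r}_m)&2(\mathbf{x},\mathbf{r}_m)&2(\mathbf{x},\mathbf{r}_m)&\mathbf{r}_m\end{array}\right)$$ is a self-orthogonal code of length $n+4$ if one of the following conditions is satisfied (where $(\mathbf{x},\mathbf{x})\in\mathbb{F}_5$): (i) $(\mathbf{x},\mathbf{x})=1$ and $\alpha^2+\beta^2+\gamma^2+\delta^2=0$; (ii) $(\mathbf{x},\mathbf{x})=2$ and $\alpha^2+\beta^2+\gamma^2+2\delta^2=0$; (iii) $(\mathbf{x},\mathbf{x})=3$ and $\alpha^2+\beta^2+\gamma^2+3\delta^2=0$; or (iv) $(\mathbf{x},\mathbf{x})=4$ and $\alpha^2+\beta^2+\gamma^2+4\delta^2=0$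.
   Context: $I_5$ is the commutative ring without unity of order 25 and characteristic 5 generated by $\mathtt{a},\mathtt{b}$ with relations $5\mathtt{a}=5\mathtt{b}=0$, $\mathtt{a}^2=\mathtt{b}$, $\mathtt{a}\mathtt{b}=0$ (hence $\mathtt{b}^2=0$); every element is uniquely $\mathtt{a}x+\mathtt{b}y$ with $x,y\in\mathbb{F}_5$. $\mathbb{F}_5$ acts naturally on $I_5$ by repeated addition. A linear code of length $n$ over $I_5$ is an $I_5$-submodule of $I_5^n$; the code with generator matrix $G$ is the smallest $I_5$-submodule (additive subgroup closed under multiplication by $I_5$) containing the rows of $G$. For $\mathbf{x}\in\mathbb{F}_5^n$, $\mathbf{r}\in I_5^n$, $(\mathbf{x},\mathbf{r})=\sum_i x_ir_i\in I_5$; for $\mathbf{y},\mathbf{z}$ both in $I_5^n$ (or both in $\mathbb{F}_5^n$), $(\mathbf{y},\mathbf{z})=\sum_i y_iz_i$. For $\delta\in I_5$ and $\mathbf{x}\in\mathbb{F}_5^n$, $\delta\mathbf{x}=(\delta x_1,\dots,\delta x_n)$. A code $\mathcal{C}$ is self-orthogonal if $(\mathbf{y},\mathbf{z})=0$ for all $\mathbf{y},\mathbf{z}\in\mathcal{C}$. *)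

theory Defs
  imports "Jordan_Normal_Form.Matrix" "HOL-Library.Numeral_Type"
begin

text \<open>
  The numeral type \<open>5\<close> of \<open>Numeral_Type\<close> carries the commutative ring structure of the
  integers modulo 5; it serves as the prime field with five elements.
\<close>

type_synonym F5 = "5"

text \<open>\<open>I5 x y\<close> stands for the element \<open>a x + b y\<close>.  The product rule is forced by the
  relations \<open>a a = b\<close> and \<open>a b = 0\<close> (whence \<open>b b = a (a b) = 0\<close>), see \<open>presentation\<close> below.
  The ring has no unity, so powers are not available and squares are written as products.\<close>

datatype I5 = I5 (coeff_a: F5) (coeff_b: F5)

instantiation I5 :: comm_ring
begin

definition zero_I5 :: I5 where
  "0 = I5 0 0"

definition plus_I5 :: "I5 \<Rightarrow> I5 \<Rightarrow> I5" where
  "r + s = I5 (coeff_a r + coeff_a s) (coeff_b r + coeff_b s)"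

definition uminus_I5 :: "I5 \<Rightarrow> I5" where
  "- r = I5 (- coeff_a r) (- coeff_b r)"

definition minus_I5 :: "I5 \<Rightarrow> I5 \<Rightarrow> I5" where
  "r - s = I5 (coeff_a r - coeff_a s) (coeff_b r - coeff_b s)"

definition times_I5 :: "I5 \<Rightarrow> I5 \<Rightarrow> I5" where
  "r * s = I5 0 (coeff_a r * coeff_a s)"

instance
  by intro_classes
    (simp_all add: zero_I5_def plus_I5_def uminus_I5_def minus_I5_def times_I5_def algebra_simps)

end

definition gen_a :: I5 where "gen_a = I5 1 0"

definition gen_b :: I5 where "gen_b = I5 0 1"

definition scal :: "F5 \<Rightarrow> I5 \<Rightarrow> I5" (infixr "*\<^sub>5" 75) where
  "c *\<^sub>5 r = I5 (c * coeff_a r) (c * coeff_b r)"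

text \<open>The action of the prime field is repeated addition.\<close>

lemma scal_of_nat: "of_nat k *\<^sub>5 r = (((+) r) ^^ k) 0"
proof (induction k)
  case 0
  show ?case by (simp add: scal_def zero_I5_def)
next
  case (Suc k)
  have "of_nat (Suc k) *\<^sub>5 r = r + of_nat k *\<^sub>5 r"
    by (simp add: scal_def plus_I5_def algebra_simps)
  with Suc show ?case by simp
qed

lemma presentation:
  "gen_a * gen_a = gen_b" "gen_a * gen_b = 0" "gen_b * gen_b = 0"
  by (simp_all add: gen_a_def gen_b_def times_I5_def zero_I5_def)

lemma characteristic: "(((+) r) ^^ 5) (0 :: I5) = 0"
proof -
  have "(of_nat 5 :: F5) = 0" by simp
  then have "of_nat 5 *\<^sub>5 r = 0" by (simp only: scal_def zero_I5_def) simp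
  then show ?thesis by (simp only: scal_of_nat)
qed

lemma ex1_I5_coordinates: "\<exists>!(x, y). r = x *\<^sub>5 gen_a + y *\<^sub>5 gen_b"
  by (cases r) (auto simp: gen_a_def gen_b_def scal_def plus_I5_def)

lemma card_I5: "card (UNIV :: I5 set) = 25"
proof -
  have "bij_betw (\<lambda>(x, y). I5 x y) (UNIV :: (F5 \<times> F5) set) UNIV"
    by (intro bij_betwI[where g = "\<lambda>r. (coeff_a r, coeff_b r)"]) auto
  then have "card (UNIV :: I5 set) = card (UNIV :: (F5 \<times> F5) set)"
    by (metis bij_betw_same_card)
  then show ?thesis by simp
qed

lemma no_unity_I5: "\<not> (\<exists>e :: I5. \<forall>r. e * r = r)"
proof
  assume "\<exists>e :: I5. \<forall>r. e * r = r"
  then obtain e :: I5 where "e * gen_a = gen_a" by blast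
  then show False by (simp add: gen_a_def times_I5_def)
qed

text \<open>
  Vectors and matrices are those of \<open>Jordan_Normal_Form.Matrix\<close>: indices start at 0, and
  \<open>v \<bullet> w\<close> is the product \<open>(v, w)\<close> of two vectors over the same ring.
\<close>

definition mixed_prod :: "F5 vec \<Rightarrow> I5 vec \<Rightarrow> I5" where
  "mixed_prod x r = (\<Sum>i<dim_vec r. (x $ i) *\<^sub>5 (r $ i))"

definition vec_mult :: "I5 \<Rightarrow> F5 vec \<Rightarrow> I5 vec" where
  "vec_mult \<delta> x = map_vec (\<lambda>c. c *\<^sub>5 \<delta>) x"

text \<open>The ring has no unity, so closure under negation does not follow from closure under
  scalar multiples.\<close>

definition linear_code :: "nat \<Rightarrow> I5 vec set \<Rightarrow> bool" where
  "linear_code n C \<longleftrightarrow>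
     C \<subseteq> carrier_vec n \<and> 0\<^sub>v n \<in> C \<and>
     (\<forall>y\<in>C. \<forall>z\<in>C. y + z \<in> C) \<and> (\<forall>y\<in>C. - y \<in> C) \<and>
     (\<forall>r. \<forall>y\<in>C. r \<cdot>\<^sub>v y \<in> C)"

text \<open>The generated code contains the rows themselves, not merely their multiples.\<close>

definition generated_code :: "I5 mat \<Rightarrow> I5 vec set" where
  "generated_code G = \<Inter> {C. linear_code (dim_col G) C \<and> set (rows G) \<subseteq> C}"

lemma linear_code_carrier: "linear_code n (carrier_vec n)"
  by (auto simp: linear_code_def)

lemma linear_generated_code: "linear_code (dim_col G) (generated_code G)"
proof -
  have "linear_code (dim_col G) (carrier_vec (dim_col G)) \<and> set (rows G) \<subseteq> carrier_vec (dim_col G)"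
    by (auto simp: linear_code_carrier rows_def)
  then have "generated_code G \<subseteq> carrier_vec (dim_col G)"
    unfolding generated_code_def by blast
  then show ?thesis
    unfolding linear_code_def[of _ "generated_code G"]
    by (auto simp: generated_code_def linear_code_def)
qed

lemma rows_generated_code: "set (rows G) \<subseteq> generated_code G"
  by (auto simp: generated_code_def)

lemma generated_code_least:
  "linear_code (dim_col G) C \<Longrightarrow> set (rows G) \<subseteq> C \<Longrightarrow> generated_code G \<subseteq> C"
  by (auto simp: generated_code_def)

definition self_orthogonal :: "I5 vec set \<Rightarrow> bool" where
  "self_orthogonal C \<longleftrightarrow> (\<forall>y\<in>C. \<forall>z\<in>C. y \<bullet> z = 0)"

end

theory Submission
  imports Defs
begin

text \<open>
  The orthogonal complement of any set of vectors is a linear code, so a generated code is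
  self-orthogonal as soon as its rows are pairwise orthogonal (complement twice, using
  symmetry). For the rows of \<open>G\<close>, the top row against itself is the quadratic condition, the top
  row against a lower row is a multiple of \<open>\<alpha> + \<beta> + 2\<gamma> + \<delta>\<close>, and the first four columns of two
  lower rows contribute a multiple of \<open>1 + 1 + 4 + 4 = 10 = 0\<close>.
\<close>

text \<open>Without a unity in \<open>I5\<close>, a scalar from \<open>F5\<close> cannot be treated
  as a ring element; these laws let it pass through products.\<close>

lemma scal_mult_left: "(c *\<^sub>5 r) * s = c *\<^sub>5 (r * s)"
  and scal_mult_right: "r * (c *\<^sub>5 s) = c *\<^sub>5 (r * s)"
  by (simp_all add: scal_def times_I5_def algebra_simps)

lemma scal_add_left: "(c + d) *\<^sub>5 r = c *\<^sub>5 r + d *\<^sub>5 r"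
  by (simp add: scal_def plus_I5_def algebra_simps)

lemma scal_scal: "c *\<^sub>5 d *\<^sub>5 r = (c * d) *\<^sub>5 r"
  by (simp add: scal_def algebra_simps)

lemma scal_zero_left [simp]: "0 *\<^sub>5 r = 0"
  and scal_zero_right [simp]: "c *\<^sub>5 0 = 0"
  and scal_one [simp]: "1 *\<^sub>5 r = r"
  by (simp_all add: scal_def zero_I5_def)

lemma scal_sum_left: "(\<Sum>i\<in>A. f i) *\<^sub>5 r = (\<Sum>i\<in>A. f i *\<^sub>5 r)"
  by (induction A rule: infinite_finite_induct) (simp_all add: scal_add_left)

text \<open>Explains the entries of the lower left block: \<open>mixed_prod x r\<close> cancels what
  the right-hand part of the top row contributes, once the coefficients sum to zero.\<close>

lemma vec_mult_scalar_prod: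
  "vec_mult \<delta> x \<bullet> r = \<delta> * mixed_prod x r" if "dim_vec x = dim_vec r"
  using that
  by (simp add: scalar_prod_def vec_mult_def mixed_prod_def sum_distrib_left
      scal_mult_left scal_mult_right lessThan_atLeast0)

text \<open>Each coordinate contributes its squared \<open>F5\<close> entry times the same
  \<open>\<delta> * \<delta>\<close>, so only the norm of \<open>x\<close> in the prime field
  matters.\<close>

lemma vec_mult_scalar_prod_vec_mult:
  "vec_mult \<delta> x \<bullet> vec_mult \<delta> x = (x \<bullet> x) *\<^sub>5 (\<delta> * \<delta>)"
  by (simp add: scalar_prod_def vec_mult_def scal_sum_left scal_mult_left scal_mult_right scal_scal)

text \<open>Orthogonality is linear in the second argument. Since \<open>S\<close> is arbitrary,
  both the rows and the whole generated code can take its place.\<close>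

lemma linear_code_orthogonal_complement:
  assumes "S \<subseteq> carrier_vec n"
  shows "linear_code n {z \<in> carrier_vec n. \<forall>s\<in>S. s \<bullet> z = 0}"
  using assms
  by (auto simp: linear_code_def scalar_prod_add_distrib subset_iff)

lemma self_orthogonal_generated_code:
  assumes "\<And>y z. y \<in> set (rows G) \<Longrightarrow> z \<in> set (rows G) \<Longrightarrow> y \<bullet> z = 0"
  shows "self_orthogonal (generated_code G)"
proof -
  let ?n = "dim_col G"
  let ?perp = "\<lambda>S. {z \<in> carrier_vec ?n. \<forall>s\<in>S. s \<bullet> z = 0}"
  have rows: "set (rows G) \<subseteq> carrier_vec ?n"
    by (auto simp: rows_def)
  have code: "generated_code G \<subseteq> carrier_vec ?n"
    using linear_generated_code by (simp add: linear_code_def)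
  have "generated_code G \<subseteq> ?perp (set (rows G))"
    using rows assms by (intro generated_code_least[OF linear_code_orthogonal_complement]) blast+
  \<comment> \<open>Symmetry swaps the roles: the rows now lie in the complement of the code, which
    is again a linear code, so minimality applies a second time.\<close>
  then have "set (rows G) \<subseteq> ?perp (generated_code G)"
    using rows comm_scalar_prod[of _ ?n] by (smt (verit) mem_Collect_eq subset_iff)
  with code have "generated_code G \<subseteq> ?perp (generated_code G)"
    by (rule generated_code_least[OF linear_code_orthogonal_complement])
  then show ?thesis
    by (auto simp: self_orthogonal_def)
qed

lemma row_mat_of_rows_list:
  "i < length vs \<Longrightarrow> length (vs ! i) = nc \<Longrightarrow> row (mat_of_rows_list nc vs) i = vec_of_list (vs ! i)"
  by (intro eq_vecI) (auto simp: mat_of_rows_list_def vec_of_list_index)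

lemma scalar_prod_vec_of_list_4:
  "vec_of_list [a, b, c, d] \<bullet> vec_of_list [a', b', c', d'] =
     a * a' + b * b' + c * c' + d * (d' :: 'a :: comm_ring)"
  by (simp add: scalar_prod_def vec_of_list_index numeral_eq_Suc add.assoc)

theorem theorem3p3:
  fixes n m :: nat
    and G\<^sub>0 G :: "I5 mat"
    and C\<^sub>0 C :: "I5 vec set"
    and x :: "F5 vec"
    and \<alpha> \<beta> \<gamma> \<delta> :: I5
  assumes "G\<^sub>0 \<in> carrier_mat m n"
    and "C\<^sub>0 = generated_code G\<^sub>0"
    and "self_orthogonal C\<^sub>0"
    and "x \<in> carrier_vec n"
    and "\<not> (\<alpha> = 0 \<and> \<beta> = 0 \<and> \<gamma> = 0 \<and> \<delta> = 0)"
    and "\<alpha> + \<beta> + 2 *\<^sub>5 \<gamma> + \<delta> = 0"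
    and "G = four_block_mat
           (mat_of_rows_list 4 [[\<alpha>, \<beta>, \<gamma>, 0]])
           (mat_of_rows n [vec_mult \<delta> x])
           (mat_of_rows_list 4
             (map (\<lambda>i. let t = mixed_prod x (row G\<^sub>0 i) in [t, t, 2 *\<^sub>5 t, 2 *\<^sub>5 t]) [0..<m]))
           G\<^sub>0"
    and "C = generated_code G"
    and "(x \<bullet> x = 1 \<and> \<alpha> * \<alpha> + \<beta> * \<beta> + \<gamma> * \<gamma> + \<delta> * \<delta> = 0) \<or>
         (x \<bullet> x = 2 \<and> \<alpha> * \<alpha> + \<beta> * \<beta> + \<gamma> * \<gamma> + 2 *\<^sub>5 (\<delta> * \<delta>) = 0) \<or>
         (x \<bullet> x = 3 \<and> \<alpha> * \<alpha> + \<beta> * \<beta> + \<gamma> * \<gamma> + 3 *\<^sub>5 (\<delta> * \<delta>) = 0) \<or>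
         (x \<bullet> x = 4 \<and> \<alpha> * \<alpha> + \<beta> * \<beta> + \<gamma> * \<gamma> + 4 *\<^sub>5 (\<delta> * \<delta>) = 0)"
  shows "linear_code (n + 4) C \<and> self_orthogonal C"
proof -
  note G\<^sub>0 = assms(1) and x = assms(4) and sum0 = assms(6) and G = assms(7)
  define t where "t i = mixed_prod x (row G\<^sub>0 i)" for i
  define top where "top = vec_of_list [\<alpha>, \<beta>, \<gamma>, 0] @\<^sub>v vec_mult \<delta> x"
  define low where "low i = vec_of_list [t i, t i, 2 *\<^sub>5 t i, 2 *\<^sub>5 t i] @\<^sub>v row G\<^sub>0 i" for i
  have vx: "vec_mult \<delta> x \<in> carrier_vec n"
    using x by (simp add: vec_mult_def)
  have r: "row G\<^sub>0 i \<in> carrier_vec n" for i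
    using G\<^sub>0 by auto
  have four: "vec_of_list [a, b, c, d] \<in> carrier_vec 4" for a b c d :: I5
    by (simp add: carrier_vecI)
  have dims: "dim_row G = Suc m" "dim_col G = n + 4"
    using G\<^sub>0 by (simp_all add: G mat_of_rows_list_def)
  have blocks:
    "mat_of_rows_list 4 [[\<alpha>, \<beta>, \<gamma>, 0]] \<in> carrier_mat 1 4"
    "mat_of_rows n [vec_mult \<delta> x] \<in> carrier_mat 1 n"
    "mat_of_rows_list 4 (map (\<lambda>i. let t = mixed_prod x (row G\<^sub>0 i) in
       [t, t, 2 *\<^sub>5 t, 2 *\<^sub>5 t]) [0..<m]) \<in> carrier_mat m 4"
    by (simp_all add: mat_of_rows_list_def mat_of_rows_def)
  have row_0: "row G 0 = top"
    using vx unfolding G top_def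
    by (subst row_four_block_mat(1)[OF blocks G\<^sub>0])
       (simp_all add: row_mat_of_rows_list del: vec_of_list_Cons)
  \<comment> \<open>The upper blocks have exactly one row, hence the shift by one.\<close>
  have row_Suc: "row G (Suc i) = low i" if "i < m" for i
    using that unfolding G low_def t_def
    by (subst row_four_block_mat(2)[OF blocks G\<^sub>0])
       (simp_all add: row_mat_of_rows_list Let_def del: vec_of_list_Cons)
  have rows: "y = top \<or> (\<exists>i<m. y = low i)" if "y \<in> set (rows G)" for y
  proof -
    from that dims obtain k where "k < Suc m" "y = row G k"
      by (auto simp: in_set_conv_nth)
    with row_0 row_Suc show ?thesis
      by (cases k) auto
  qed
  have "row G\<^sub>0 i \<in> C\<^sub>0" if "i < m" for i
    using that G\<^sub>0 rows_generated_code[of G\<^sub>0] assms(2) by (auto simp: rows_def)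
  then have orth: "row G\<^sub>0 i \<bullet> row G\<^sub>0 j = 0" if "i < m" "j < m" for i j
    using that assms(3) by (simp add: self_orthogonal_def)
  have app: "(u @\<^sub>v v) \<bullet> (u' @\<^sub>v v') = u \<bullet> u' + v \<bullet> v'"
    if "u \<in> carrier_vec 4" "u' \<in> carrier_vec 4" "v \<in> carrier_vec n" "v' \<in> carrier_vec n"
    for u u' v v' :: "I5 vec"
    using scalar_prod_append that by blast
  \<comment> \<open>All four alternatives are one equation, with \<open>x \<bullet> x\<close> as the
    coefficient of \<open>\<delta> * \<delta>\<close>; in the first one that coefficient is
    1.\<close>
  have top_top: "top \<bullet> top = 0"
    using assms(9) unfolding top_def
    by (auto simp: app[OF four four vx vx] scalar_prod_vec_of_list_4 vec_mult_scalar_prod_vec_mult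
        add.assoc simp del: vec_of_list_Cons)
  have top_low: "top \<bullet> low i = 0" for i
  proof -
    have "vec_mult \<delta> x \<bullet> row G\<^sub>0 i = \<delta> * t i"
      using x r[of i] unfolding t_def by (intro vec_mult_scalar_prod) (metis carrier_vecD)
    \<comment> \<open>The factor 2 of the third column moves onto \<open>\<gamma>\<close>, and the
      fourth column meets the entry 0 of \<open>top\<close>.\<close>
    then have "top \<bullet> low i = \<alpha> * t i + \<beta> * t i + (2 *\<^sub>5 \<gamma>) * t i + \<delta> * t i"
      unfolding top_def low_def
      by (simp add: app[OF four four vx r] scalar_prod_vec_of_list_4 scal_mult_left scal_mult_right
          del: vec_of_list_Cons)
    also have "\<dots> = (\<alpha> + \<beta> + 2 *\<^sub>5 \<gamma> + \<delta>) * t i"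
      by (simp only: distrib_right)
    finally show ?thesis
      using sum0 by simp
  qed
  have "top \<in> carrier_vec (4 + n)" "low i \<in> carrier_vec (4 + n)" for i
    unfolding top_def low_def by (intro append_carrier_vec four vx r)+
  then have low_top: "low i \<bullet> top = 0" for i
    using top_low by (metis comm_scalar_prod)
  have low_low: "low i \<bullet> low j = 0" if "i < m" "j < m" for i j
  proof -
    \<comment> \<open>The right-hand parts vanish by \<open>orth\<close>. The coefficient is
      collected in \<open>F5\<close>, where characteristic 5 makes it zero.\<close>
    have "low i \<bullet> low j = (1 + 1 + 2 * 2 + 2 * 2) *\<^sub>5 (t i * t j)"
      using that orth unfolding low_def
      by (simp only: app[OF four four r r] scalar_prod_vec_of_list_4 scal_mult_left scal_mult_right
          scal_scal scal_add_left scal_one) simp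
    moreover have "(1 + 1 + 2 * 2 + 2 * 2 :: F5) = 0"
      by simp
    ultimately show ?thesis
      by (simp only: scal_zero_left)
  qed
  have "self_orthogonal (generated_code G)"
    by (rule self_orthogonal_generated_code)
       (auto dest!: rows simp: top_top top_low low_top low_low)
  then show ?thesis
    using linear_generated_code[of G] dims assms(8) by simp
qed

end
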